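(* Let $C$ and $D$ be nonempty subsets of a smooth real Banach space $E$, and let $S\colon C\to E$ and $T\colon D\to E$ be quasinonexpansive mappings with respect to $\phi$ such that $T(D)\subset C$ and $\mathrm{F}(S)\cap\mathrm{F}(T)$ is nonempty. Then the following hold: (1) If $S$ or $T$ is strictly quasinonexpansive with respect to $\phi$, then $\mathrm{F}(S)\cap\mathrm{F}(T)=\mathrm{F}(ST)$ and $ST\colon D\to E$ is quasinonexpansive with respect to $\phi$. (2) If $E$ is uniformly convex and both $S$ and $T$ are strongly quasinonexpansive with respect to $\phi$, then $ST$ is strongly quasinonexpansive with respect to $\phi$.
   Context: For a smooth real Banach space $E$ with dual $E^*$, the (normalized) duality mapping $J\colon E\to E^*$ is single-valued: $Jx$ is the unique $x^*\in E^*$ with $\langle x,x^*\rangle=\|x\|^2=\|x^*\|^2$, where $\langle x,x^*\rangle$ is the value of $x^*$ at $x$. The function $\phi\colon E\times E\to[0,\infty)$ is $\phi(x,y)=\|x\|^2-2\langle x,Jy\rangle+\|y\|^2$, and $\bar{B}(z,M)=\{x\in E:\phi(z,x)\le M\}$ for $z\in E$, $M>0$ (defined via $\phi$, not the norm). For $A\subset E$ and $U\colon A\to E$, $\mathrm{F}(U)=\{z\in A: z=Uz\}$. $U$ is quasinonexpansive with respect to $\phi$ if $\mathrm{F}(U)\neq\emptyset$ and $\phi(z,Ux)\le\phi(z,x)$ for all $z\in\mathrm{F}(U)$, $x\in A$; strictly quasinonexpansive with respect to $\phi$ if $\mathrm{F}(U)\neq\emptyset$ and $\phi(z,Ux)<\phi(z,x)$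 for all $z\in\mathrm{F}(U)$, $x\in A\setminus\mathrm{F}(U)$; strongly quasinonexpansive with respect to $\phi$ if $\mathrm{F}(U)\neq\emptyset$ and for any $z\in\mathrm{F}(U)$, $M>0$ and $\epsilon>0$ there exists $\delta>0$ such that $x\in A\cap\bar{B}(z,M)$ and $\phi(z,x)-\phi(z,Ux)<\delta$ imply $\phi(Ux,x)<\epsilon$. $ST$ denotes the composition $x\mapsto S(Tx)$ on $D$. *)

theory Defs
  imports "HOL-Analysis.Analysis"
begin

text \<open>A Banach space is a type of class \<open>banach\<close>; its dual is the type of bounded
  linear functionals \<open>'a \<Rightarrow>\<^sub>L real\<close> with the operator norm. The map
  \<open>U : A \<rightarrow> E\<close> is a total function \<open>U\<close> together with the set \<open>A\<close>; no definition
  below depends on the values of \<open>U\<close> outside \<open>A\<close>.\<close>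

definition smooth_space :: "'a::real_normed_vector itself \<Rightarrow> bool" where
  "smooth_space _ \<longleftrightarrow> (\<forall>x y :: 'a. norm x = 1 \<longrightarrow> norm y = 1 \<longrightarrow>
     (\<exists>l. ((\<lambda>t::real. (norm (x + t *\<^sub>R y) - norm x) / t) \<longlongrightarrow> l) (at 0)))"

definition uniformly_convex_space :: "'a::real_normed_vector itself \<Rightarrow> bool" where
  "uniformly_convex_space _ \<longleftrightarrow> (\<forall>\<epsilon>::real. 0 < \<epsilon> \<longrightarrow> \<epsilon> \<le> 2 \<longrightarrow>
     (\<exists>\<delta>>0. \<forall>x y :: 'a. norm x = 1 \<longrightarrow> norm y = 1 \<longrightarrow> norm (x - y) \<ge> \<epsilon> \<longrightarrow>
        norm ((x + y) /\<^sub>R 2) \<le> 1 - \<delta>))"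

definition is_duality :: "'a::real_normed_vector \<Rightarrow> ('a \<Rightarrow>\<^sub>L real) \<Rightarrow> bool" where
  "is_duality x f \<longleftrightarrow> blinfun_apply f x = (norm x)\<^sup>2 \<and> (norm x)\<^sup>2 = (norm f)\<^sup>2"

text \<open>Meaningful in smooth spaces only, where the functional exists and is unique
  (see \<open>smooth_duality_ex1\<close> below).\<close>

definition duality_map :: "'a::real_normed_vector \<Rightarrow> ('a \<Rightarrow>\<^sub>L real)" where
  "duality_map x = (THE f. is_duality x f)"

definition phi :: "'a::real_normed_vector \<Rightarrow> 'a \<Rightarrow> real" where
  "phi x y = (norm x)\<^sup>2 - 2 * blinfun_apply (duality_map y) x + (norm y)\<^sup>2"

definition phi_ball :: "'a::real_normed_vector \<Rightarrow> real \<Rightarrow> 'a set" where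
  "phi_ball z M = {x. phi z x \<le> M}"

definition fixed_points :: "'a set \<Rightarrow> ('a \<Rightarrow> 'a) \<Rightarrow> 'a set" where
  "fixed_points A U = {z \<in> A. z = U z}"

definition quasinonexpansive :: "'a::real_normed_vector set \<Rightarrow> ('a \<Rightarrow> 'a) \<Rightarrow> bool" where
  "quasinonexpansive A U \<longleftrightarrow> fixed_points A U \<noteq> {} \<and>
     (\<forall>z \<in> fixed_points A U. \<forall>x \<in> A. phi z (U x) \<le> phi z x)"

definition strictly_quasinonexpansive :: "'a::real_normed_vector set \<Rightarrow> ('a \<Rightarrow> 'a) \<Rightarrow> bool" where
  "strictly_quasinonexpansive A U \<longleftrightarrow> fixed_points A U \<noteq> {} \<and>
     (\<forall>z \<in> fixed_points A U. \<forall>x \<in> A - fixed_points A U. phi z (U x) < phi z x)"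

definition strongly_quasinonexpansive :: "'a::real_normed_vector set \<Rightarrow> ('a \<Rightarrow> 'a) \<Rightarrow> bool" where
  "strongly_quasinonexpansive A U \<longleftrightarrow> fixed_points A U \<noteq> {} \<and>
     (\<forall>z \<in> fixed_points A U. \<forall>M>0. \<forall>\<epsilon>>0. \<exists>\<delta>>0. \<forall>x \<in> A \<inter> phi_ball z M.
        phi z x - phi z (U x) < \<delta> \<longrightarrow> phi (U x) x < \<epsilon>)"

subsection \<open>Single-valuedness of the duality mapping\<close>

lemma smooth_limit:
  fixes u y :: "'a::real_normed_vector"
  assumes sm: "smooth_space TYPE('a)" and u: "norm u = 1"
  shows "\<exists>l. ((\<lambda>t::real. (norm (u + t *\<^sub>R y) - norm u) / t) \<longlongrightarrow> l) (at 0)"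
proof (cases "y = 0")
  case True
  then show ?thesis by (intro exI[of _ 0]) simp
next
  case False
  define v where "v = y /\<^sub>R norm y"
  have v: "norm v = 1" "y = norm y *\<^sub>R v" using False by (auto simp: v_def)
  obtain l where l: "((\<lambda>t::real. (norm (u + t *\<^sub>R v) - norm u) / t) \<longlongrightarrow> l) (at 0)"
    using sm u v(1) unfolding smooth_space_def by blast
  have "filterlim (\<lambda>t::real. t * norm y) (at 0) (at 0)"
    unfolding filterlim_at using False
    by (auto intro!: tendsto_eq_intros simp: eventually_at_filter)
  from filterlim_compose[OF l this]
  have "((\<lambda>t::real. norm y * ((norm (u + (t * norm y) *\<^sub>R v) - norm u) / (t * norm y)))
    \<longlongrightarrow> norm y * l) (at 0)"
    by (intro tendsto_mult tendsto_const)
  moreover have "norm y * ((norm (u + (t * norm y) *\<^sub>R v) - norm u) / (t * norm y))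
      = (norm (u + t *\<^sub>R y) - norm u) / t" for t
  proof -
    have "(t * norm y) *\<^sub>R v = t *\<^sub>R y" using v(2) by (metis scaleR_scaleR)
    then show ?thesis using False by simp
  qed
  ultimately show ?thesis by auto
qed

lemma smooth_duality_unit:
  fixes u :: "'a::real_normed_vector"
  assumes sm: "smooth_space TYPE('a)" and u: "norm u = 1"
  shows "\<exists>!f. is_duality u f"
proof -
  obtain G where G: "\<And>y. ((\<lambda>t::real. (norm (u + t *\<^sub>R y) - norm u) / t) \<longlongrightarrow> G y) (at 0)"
    using smooth_limit[OF sm u] by metis
  have Gr: "((\<lambda>t::real. (norm (u + t *\<^sub>R y) - norm u) / t) \<longlongrightarrow> G y) (at_right 0)" for y
    using G[of y] filterlim_at_split by blast
  have pos: "eventually (\<lambda>t::real. t > 0) (at_right 0)"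
    by (simp add: eventually_at_right_less)
  have Gsc: "G (c *\<^sub>R y) = c * G y" for c y
  proof (cases "c = 0")
    case True
    have "((\<lambda>t::real. 0) \<longlongrightarrow> G 0) (at 0)" using G[of 0] by simp
    then show ?thesis using True by (simp add: tendsto_const_iff)
  next
    case False
    have "filterlim (\<lambda>t::real. t * c) (at 0) (at 0)"
      unfolding filterlim_at using False
      by (auto intro!: tendsto_eq_intros simp: eventually_at_filter)
    from filterlim_compose[OF G[of y] this]
    have "((\<lambda>t::real. c * ((norm (u + (t * c) *\<^sub>R y) - norm u) / (t * c))) \<longlongrightarrow> c * G y) (at 0)"
      by (intro tendsto_mult tendsto_const)
    moreover have "c * ((norm (u + (t * c) *\<^sub>R y) - norm u) / (t * c))
        = (norm (u + t *\<^sub>R (c *\<^sub>R y)) - norm u) / t" for t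
      using False by simp
    ultimately have "((\<lambda>t::real. (norm (u + t *\<^sub>R (c *\<^sub>R y)) - norm u) / t) \<longlongrightarrow> c * G y) (at 0)"
      by simp
    then show ?thesis using G[of "c *\<^sub>R y"] LIM_unique by blast
  qed
  have Gsub: "G (y + z) \<le> G y + G z" for y z
  proof -
    have "G (y + z) \<le> (G (2 *\<^sub>R y) + G (2 *\<^sub>R z)) / 2"
    proof (rule tendsto_le[OF trivial_limit_at_right_real _ Gr])
      show "((\<lambda>t. ((norm (u + t *\<^sub>R (2 *\<^sub>R y)) - norm u) / t
          + (norm (u + t *\<^sub>R (2 *\<^sub>R z)) - norm u) / t) / 2)
          \<longlongrightarrow> (G (2 *\<^sub>R y) + G (2 *\<^sub>R z)) / 2) (at_right 0)"
        by (intro tendsto_intros Gr) auto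
      show "\<forall>\<^sub>F t in at_right 0. (norm (u + t *\<^sub>R (y + z)) - norm u) / t
          \<le> ((norm (u + t *\<^sub>R (2 *\<^sub>R y)) - norm u) / t
          + (norm (u + t *\<^sub>R (2 *\<^sub>R z)) - norm u) / t) / 2"
        using pos
      proof eventually_elim
        case (elim t)
        have "2 *\<^sub>R (u + t *\<^sub>R (y + z)) = (u + t *\<^sub>R (2 *\<^sub>R y)) + (u + t *\<^sub>R (2 *\<^sub>R z))"
          by (simp add: scaleR_add_right scaleR_2[of u] mult.commute)
        then have "2 * norm (u + t *\<^sub>R (y + z))
            \<le> norm (u + t *\<^sub>R (2 *\<^sub>R y)) + norm (u + t *\<^sub>R (2 *\<^sub>R z))"
          by (metis norm_triangle_ineq norm_scaleR abs_numeral)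
        then have "norm (u + t *\<^sub>R (y + z)) - norm u
            \<le> ((norm (u + t *\<^sub>R (2 *\<^sub>R y)) - norm u)
              + (norm (u + t *\<^sub>R (2 *\<^sub>R z)) - norm u)) / 2"
          by simp
        from divide_right_mono[OF this, of t] elim show ?case
          by (simp only: add_divide_distrib divide_divide_eq_left mult.commute)
      qed
    qed
    then show ?thesis by (simp add: Gsc)
  qed
  have Gm: "G (- y) = - G y" for y using Gsc[of "-1" y] by simp
  have Gadd: "G (y + z) = G y + G z" for y z
    using Gsub[of y z] Gsub[of "-y" "-z"] Gm[of "y + z"] by (simp add: Gm add.commute)
  have Gle: "G y \<le> norm y" for y
  proof (rule tendsto_upperbound[OF Gr])
    show "\<forall>\<^sub>F t in at_right 0. (norm (u + t *\<^sub>R y) - norm u) / t \<le> norm y"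
      using pos
    proof eventually_elim
      case (elim t)
      have "norm (u + t *\<^sub>R y) \<le> norm u + t * norm y"
        using norm_triangle_ineq[of u "t *\<^sub>R y"] elim by simp
      then show ?case using elim by (simp add: field_simps)
    qed
  qed simp
  have Gabs: "norm (G y) \<le> norm y * 1" for y
    using Gle[of y] Gle[of "-y"] by (simp add: Gm abs_le_iff)
  have bl: "bounded_linear G"
    by (rule bounded_linear_intro[OF Gadd _ Gabs]) (simp add: Gsc)
  have Gu: "G u = 1"
  proof -
    have "(\<lambda>t::real. (norm (u + t *\<^sub>R u) - norm u) / t) \<midarrow>0\<rightarrow> 1"
    proof (rule tendsto_eventually)
      show "\<forall>\<^sub>F t in at 0. (norm (u + t *\<^sub>R u) - norm u) / t = 1"
        unfolding eventually_at
      proof (intro exI[of _ 1] conjI ballI impI)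
        fix t :: real assume "t \<noteq> 0 \<and> dist t 0 < 1"
        moreover have "norm (u + t *\<^sub>R u) = \<bar>1 + t\<bar>"
          using u by (metis scaleR_add_left scaleR_one norm_scaleR mult.right_neutral)
        ultimately show "(norm (u + t *\<^sub>R u) - norm u) / t = 1" using u by auto
      qed simp
    qed
    then show ?thesis using G[of u] LIM_unique by blast
  qed
  define g where "g = Blinfun G"
  have g: "blinfun_apply g = G" unfolding g_def by (rule bounded_linear_Blinfun_apply[OF bl])
  have "norm g \<le> 1"
    by (rule norm_blinfun_bound) (use Gabs in \<open>auto simp: g mult.commute\<close>)
  moreover have "1 \<le> norm g" using norm_blinfun[of g u] Gu u by (simp add: g)
  ultimately have "is_duality u g" using u Gu by (simp add: is_duality_def g)
  moreover have "f = g" if f: "is_duality u f" for f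
  proof -
    have f1: "blinfun_apply f u = 1" "norm f = 1"
      using f u by (auto simp: is_duality_def power2_eq_1_iff) (metis abs_norm_cancel abs_neg_one one_neq_neg_one)+
    have le: "blinfun_apply f y \<le> G y" for y
    proof (rule tendsto_lowerbound[OF Gr])
      show "\<forall>\<^sub>F t in at_right 0. blinfun_apply f y \<le> (norm (u + t *\<^sub>R y) - norm u) / t"
        using pos
      proof eventually_elim
        case (elim t)
        have "1 + t * blinfun_apply f y \<le> norm (u + t *\<^sub>R y)"
          using norm_blinfun[of f "u + t *\<^sub>R y"] f1
          by (simp add: blinfun.add_right blinfun.scaleR_right)
        then show ?case using elim u by (simp add: field_simps)
      qed
    qed simp
    have "blinfun_apply f y = G y" for y
      using le[of y] le[of "-y"] by (simp add: Gm blinfun.minus_right)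
    then show ?thesis by (intro blinfun_eqI) (simp add: g)
  qed
  ultimately show ?thesis by blast
qed

lemma is_duality_scaleR:
  assumes "is_duality x f"
  shows "is_duality (c *\<^sub>R x) (c *\<^sub>R f)"
  using assms by (simp add: is_duality_def blinfun.scaleR_left blinfun.scaleR_right
      power_mult_distrib power2_eq_square[of c])

lemma smooth_duality_ex1:
  fixes x :: "'a::real_normed_vector"
  assumes sm: "smooth_space TYPE('a)"
  shows "\<exists>!f. is_duality x f"
proof (cases "x = 0")
  case True
  then show ?thesis by (intro ex1I[of _ 0]) (auto simp: is_duality_def)
next
  case False
  let ?n = "norm x"
  have "norm (x /\<^sub>R ?n) = 1" using False by simp
  from smooth_duality_unit[OF sm this] obtain g where g: "is_duality (x /\<^sub>R ?n) g"
    and uniq: "\<And>f. is_duality (x /\<^sub>R ?n) f \<Longrightarrow> f = g" by blast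
  have "is_duality x (?n *\<^sub>R g)" using is_duality_scaleR[OF g, of ?n] False by simp
  moreover have "f = ?n *\<^sub>R g" if "is_duality x f" for f
    using uniq[OF is_duality_scaleR[OF that, of "inverse ?n"]] False by auto
  ultimately show ?thesis by blast
qed

lemma duality_map_is_duality:
  fixes x :: "'a::real_normed_vector"
  assumes "smooth_space TYPE('a)"
  shows "is_duality x (duality_map x)"
  unfolding duality_map_def by (rule theI'[OF smooth_duality_ex1[OF assms]])

end

theory Submission
  imports Defs
begin

text \<open>
  For a common fixed point \<open>u\<close> we have \<open>\<phi>(u, STx) \<le> \<phi>(u, Tx) \<le> \<phi>(u, x)\<close>, so a fixed point of \<open>ST\<close>
  forces equality twice, and strictness of one map makes the point fixed by both. In the uniformly
  convex case \<open>\<phi>(x, y)\<close> small with \<open>y\<close> bounded forces \<open>\<parallel>x - y\<parallel>\<close> small; in particular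
  strongly implies strictly quasinonexpansive. The three-point identity
  \<open>\<phi>(w, x) = \<phi>(w, y) + \<phi>(y, x) + 2 \<langle>w - y, Jy - Jx\<rangle>\<close> at \<open>y = Tx\<close>, \<open>w = STx\<close> then bounds
  \<open>\<phi>(STx, x)\<close>, because \<open>Jy - Jx\<close> stays bounded.
\<close>

section \<open>Elementary estimates for the duality mapping and \<open>phi\<close>\<close>

lemma duality_map_self:
  assumes "smooth_space TYPE('a::real_normed_vector)"
  shows "blinfun_apply (duality_map (x::'a)) x = (norm x)\<^sup>2"
  using duality_map_is_duality[OF assms, of x] by (simp add: is_duality_def)

lemma norm_duality_map:
  assumes "smooth_space TYPE('a::real_normed_vector)"
  shows "norm (duality_map (x::'a)) = norm x"
  using duality_map_is_duality[OF assms, of x] by (simp add: is_duality_def)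

lemma duality_map_le:
  assumes "smooth_space TYPE('a::real_normed_vector)"
  shows "blinfun_apply (duality_map (y::'a)) x \<le> norm y * norm x"
  using norm_blinfun[of "duality_map y" x] norm_duality_map[OF assms, of y]
  by (simp add: abs_le_iff)

lemma norm_diff_square_le_phi:
  assumes "smooth_space TYPE('a::real_normed_vector)"
  shows "(norm (x::'a) - norm y)\<^sup>2 \<le> phi x y"
  using duality_map_le[OF assms, of y x] by (simp add: phi_def power2_diff mult.commute)

lemma phi_nonneg:
  assumes "smooth_space TYPE('a::real_normed_vector)"
  shows "0 \<le> phi (x::'a) y"
  using norm_diff_square_le_phi[OF assms, of x y] zero_le_power2 order_trans by blast

text \<open>Makes balls defined by \<open>phi\<close> norm bounded; the estimate from uniform
  convexity below is uniform only over bounded second arguments.\<close>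

lemma norm_le_of_phi_le:
  assumes "smooth_space TYPE('a::real_normed_vector)" and "phi (z::'a) x \<le> M"
  shows "norm x \<le> norm z + sqrt M"
proof -
  have "(norm z - norm x)\<^sup>2 \<le> M"
    using norm_diff_square_le_phi[OF assms(1), of z x] assms(2) by linarith
  then have "\<bar>norm z - norm x\<bar> \<le> sqrt M"
    using real_sqrt_le_mono by fastforce
  then show ?thesis by linarith
qed

lemma phi_three_point:
  assumes "smooth_space TYPE('a::real_normed_vector)"
  shows "phi (w::'a) x = phi w y + phi y x
    + 2 * blinfun_apply (duality_map y - duality_map x) (w - y)"
  by (simp add: phi_def blinfun.diff_left blinfun.diff_right duality_map_self[OF assms])

text \<open>Only \<open>norm (duality_map v) = norm v\<close> enters, no continuity of the duality
  mapping: the cross term becomes small through \<open>w - y\<close> alone.\<close>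

lemma phi_le_three_point:
  assumes "smooth_space TYPE('a::real_normed_vector)"
  shows "phi (w::'a) x \<le> phi w y + phi y x + 2 * (norm y + norm x) * norm (w - y)"
proof -
  let ?f = "duality_map y - duality_map x"
  have "norm ?f \<le> norm y + norm x"
    using norm_triangle_ineq4[of "duality_map y" "duality_map x"]
    by (simp add: norm_duality_map[OF assms])
  then have "norm ?f * norm (w - y) \<le> (norm y + norm x) * norm (w - y)"
    by (rule mult_right_mono) simp
  then have "blinfun_apply ?f (w - y) \<le> (norm y + norm x) * norm (w - y)"
    using norm_blinfun[of ?f "w - y"] by (simp add: abs_le_iff)
  then show ?thesis by (simp add: phi_three_point[OF assms, of w x y] mult.assoc del: distrib_left_numeral)
qed

text \<open>Splitting \<open>\<phi>(x, y) = (\<parallel>x\<parallel> - \<parallel>y\<parallel>)\<^sup>2 + 2 (\<parallel>x\<parallel>\<parallel>y\<parallel> - \<langle>x, Jy\<rangle>)\<close>, the first term controls the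
  difference of the norms, and the second, via the midpoint of the normalised vectors and the
  norming functional \<open>Jy / \<parallel>y\<parallel>\<close>, the angle.\<close>

lemma phi_small_imp_close:
  assumes sm: "smooth_space TYPE('a::real_normed_vector)"
    and uc: "uniformly_convex_space TYPE('a)"
    and r: "0 < r" and e: "0 < \<eta>"
  obtains \<delta> where "0 < \<delta>"
    "\<And>x y :: 'a. norm y \<le> r \<Longrightarrow> phi x y < \<delta> \<Longrightarrow> norm (x - y) < \<eta>"
proof -
  \<comment> \<open>The cap 2 is the range of the modulus. The other value fits the directions: they
    will satisfy \<open>\<eta> / 2 \<le> norm y * norm (x' - y')\<close> with
    \<open>norm y \<le> r\<close>.\<close>
  define e' where "e' = min 2 (\<eta> / (2 * r))"
  have "0 < e'" "e' \<le> 2" using r e by (auto simp: e'_def)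
  then obtain d where d: "0 < d" and ucd: "\<And>x y :: 'a. norm x = 1 \<Longrightarrow> norm y = 1 \<Longrightarrow>
      norm (x - y) \<ge> e' \<Longrightarrow> norm ((x + y) /\<^sub>R 2) \<le> 1 - d"
    using uc unfolding uniformly_convex_space_def by blast
  \<comment> \<open>The first bound keeps the norms within \<open>\<eta> / 4\<close> of each other;
    the second lies below the angle deficit \<open>4 * d * (\<eta> / 8) * (3 * \<eta> / 8)\<close>
    reached at the end.\<close>
  define \<delta> where "\<delta> = min ((\<eta> / 4)\<^sup>2) (d * \<eta>\<^sup>2 / 8)"
  have "0 < \<delta>" using d e by (simp add: \<delta>_def)
  moreover have "norm (x - y) < \<eta>" if y: "norm y \<le> r" and p: "phi x y < \<delta>" for x y :: 'a
  proof (rule ccontr)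
    assume far: "\<not> norm (x - y) < \<eta>"
    have "(norm x - norm y)\<^sup>2 < (\<eta> / 4)\<^sup>2"
      using norm_diff_square_le_phi[OF sm, of x y] p by (simp add: \<delta>_def)
    then have nd: "\<bar>norm x - norm y\<bar> < \<eta> / 4"
      using e by (intro power2_less_imp_less[of "\<bar>norm x - norm y\<bar>"]) simp_all
    have tri: "norm (x - y) \<le> norm x + norm y" by (rule norm_triangle_ineq4)
    \<comment> \<open>The norms sum to at least \<eta> and nearly agree, so neither is small:
      normalising is legitimate and the angle deficit stays bounded below.\<close>
    have ny: "3 * \<eta> / 8 \<le> norm y" and nx: "\<eta> / 8 \<le> norm x"
      using tri nd far by linarith+
    then have pos: "0 < norm x" "0 < norm y" using e by linarith+
    define x' y' where "x' = x /\<^sub>R norm x" and "y' = y /\<^sub>R norm y"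
    have u: "norm x' = 1" "norm y' = 1" and xy: "x = norm x *\<^sub>R x'" "y = norm y *\<^sub>R y'"
      using pos by (auto simp: x'_def y'_def)
    have "x - y = (norm x - norm y) *\<^sub>R x' + norm y *\<^sub>R (x' - y')"
      using xy[symmetric] by (simp add: scaleR_diff_left scaleR_diff_right)
    then have "norm (x - y) \<le> \<bar>norm x - norm y\<bar> + norm y * norm (x' - y')"
      by (metis norm_triangle_ineq norm_scaleR u(1) mult.right_neutral abs_norm_cancel)
    then have "\<eta> / 2 \<le> norm y * norm (x' - y')" using nd far e by linarith
    also have "\<dots> \<le> r * norm (x' - y')" using y by (rule mult_right_mono) simp
    finally have "e' \<le> norm (x' - y')"
      using r by (simp add: e'_def min_le_iff_disj field_simps)
    from ucd[OF u this] have mid: "norm (x' + y') \<le> 2 - 2 * d" by simp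
    let ?J = "blinfun_apply (duality_map y)"
    have Jy: "?J y' = norm y"
      using pos by (simp add: y'_def blinfun.scaleR_right duality_map_self[OF sm] power2_eq_square)
    \<comment> \<open>Testing the short midpoint against the functional that norms \<open>y'\<close>
      leaves \<open>?J x'\<close> below \<open>norm y\<close> by at least
      \<open>2 * d * norm y\<close>.\<close>
    have "?J x' + norm y \<le> norm y * norm (x' + y')"
      using duality_map_le[OF sm, of y "x' + y'"] by (simp add: blinfun.add_right Jy)
    also have "\<dots> \<le> norm y * (2 - 2 * d)" using mid by (rule mult_left_mono) simp
    finally have "?J x' \<le> norm y - 2 * d * norm y" by (simp add: algebra_simps)
    then have "norm x * ?J x' \<le> norm x * (norm y - 2 * d * norm y)"
      by (rule mult_left_mono) simp
    moreover have "?J x = norm x * ?J x'"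
      using xy(1) by (metis blinfun.scaleR_right real_scaleR_def)
    ultimately have "4 * d * (norm x * norm y) \<le> phi x y - (norm x - norm y)\<^sup>2"
      by (simp add: phi_def power2_diff algebra_simps)
    then have "4 * d * (norm x * norm y) \<le> phi x y"
      using zero_le_power2[of "norm x - norm y"] by linarith
    moreover have "4 * d * (\<eta> / 8 * (3 * \<eta> / 8)) \<le> 4 * d * (norm x * norm y)"
      using nx ny e d by (intro mult_left_mono mult_mono) auto
    moreover have "d * \<eta>\<^sup>2 / 8 \<le> 4 * d * (\<eta> / 8 * (3 * \<eta> / 8))"
      using d e by (simp add: power2_eq_square field_simps)
    ultimately show False using p by (simp add: \<delta>_def)
  qed
  ultimately show ?thesis by (rule that)
qed

lemma phi_eq_0_imp_eq:
  assumes "smooth_space TYPE('a::real_normed_vector)" and "uniformly_convex_space TYPE('a)"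
    and "phi (x::'a) y = 0"
  shows "x = y"
proof (rule ccontr)
  assume "x \<noteq> y"
  then have "0 < norm (x - y)" by simp
  \<comment> \<open>The summand 1 keeps the radius positive when \<open>y = 0\<close>.\<close>
  moreover have "0 < norm y + 1" by (simp add: add_nonneg_pos)
  ultimately obtain \<delta> where "0 < \<delta>" "\<And>u v :: 'a. norm v \<le> norm y + 1 \<Longrightarrow>
      phi u v < \<delta> \<Longrightarrow> norm (u - v) < norm (x - y)"
    using phi_small_imp_close[OF assms(1,2)] by blast
  from this(1) this(2)[of y x] assms(3) show False by simp
qed

text \<open>Without a strict decrease at \<open>x\<close>, the difference of \<open>phi\<close>
  values is below every \<delta>, so \<open>phi (U x) x\<close> is below every \<epsilon> and
  \<open>x\<close> is fixed.\<close>

lemma strongly_imp_strictly_quasinonexpansive: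
  fixes A :: "'a::real_normed_vector set"
  assumes sm: "smooth_space TYPE('a)" and uc: "uniformly_convex_space TYPE('a)"
    and U: "strongly_quasinonexpansive A U"
  shows "strictly_quasinonexpansive A U"
  unfolding strictly_quasinonexpansive_def
proof (intro conjI ballI)
  show "fixed_points A U \<noteq> {}" using U by (simp add: strongly_quasinonexpansive_def)
  fix z x assume z: "z \<in> fixed_points A U" and x: "x \<in> A - fixed_points A U"
  show "phi z (U x) < phi z x"
  proof (rule ccontr)
    assume *: "\<not> phi z (U x) < phi z x"
    \<comment> \<open>A positive radius whose ball contains \<open>x\<close>, even if
      \<open>phi z x\<close> vanishes.\<close>
    have M: "0 < phi z x + 1" using phi_nonneg[OF sm, of z x] by linarith
    have small: "phi (U x) x < \<epsilon>" if "0 < \<epsilon>" for \<epsilon>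
    proof -
      have "\<forall>M>0. \<forall>\<epsilon>>0. \<exists>\<delta>>0. \<forall>v \<in> A \<inter> phi_ball z M.
          phi z v - phi z (U v) < \<delta> \<longrightarrow> phi (U v) v < \<epsilon>"
        using U z unfolding strongly_quasinonexpansive_def by blast
      from this[rule_format, OF M that] obtain \<delta> where "\<delta> > 0"
        "\<And>v. v \<in> A \<inter> phi_ball z (phi z x + 1) \<Longrightarrow>
          phi z v - phi z (U v) < \<delta> \<Longrightarrow> phi (U v) v < \<epsilon>"
        by blast
      then show ?thesis using x * by (simp add: phi_ball_def)
    qed
    have "phi (U x) x = 0"
      using small[of "phi (U x) x"] phi_nonneg[OF sm, of "U x" x] by linarith
    then have "U x = x" by (rule phi_eq_0_imp_eq[OF sm uc])
    then show False using x by (simp add: fixed_points_def)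
  qed
qed

section \<open>Fixed points and compositions\<close>

lemma fixed_points_comp:
  assumes S: "quasinonexpansive C S" and T: "quasinonexpansive D T" and TD: "T ` D \<subseteq> C"
    and ne: "fixed_points C S \<inter> fixed_points D T \<noteq> {}"
    and strict: "strictly_quasinonexpansive C S \<or> strictly_quasinonexpansive D T"
  shows "fixed_points D (S \<circ> T) = fixed_points C S \<inter> fixed_points D T"
proof
  show "fixed_points C S \<inter> fixed_points D T \<subseteq> fixed_points D (S \<circ> T)"
    by (auto simp: fixed_points_def)
  obtain u where u: "u \<in> fixed_points C S" "u \<in> fixed_points D T" using ne by blast
  show "fixed_points D (S \<circ> T) \<subseteq> fixed_points C S \<inter> fixed_points D T"
  proof
    fix z assume "z \<in> fixed_points D (S \<circ> T)"
    then have z: "z \<in> D" "S (T z) = z" by (auto simp: fixed_points_def)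
    then have Tz: "T z \<in> C" using TD by blast
    have "phi u (S (T z)) \<le> phi u (T z)" "phi u (T z) \<le> phi u z"
      using S T u z Tz unfolding quasinonexpansive_def by blast+
    then have eq: "phi u (S (T z)) = phi u (T z)" "phi u (T z) = phi u z"
      using z by simp_all
    from strict have "T z \<in> fixed_points C S \<or> z \<in> fixed_points D T"
      using u z(1) Tz eq unfolding strictly_quasinonexpansive_def by (metis DiffI less_irrefl)
    \<comment> \<open>If \<open>S\<close> fixes \<open>T z\<close>, then
      \<open>T z = S (T z) = z\<close>; the other case is immediate.\<close>
    then have "T z = z" using z by (auto simp: fixed_points_def)
    then show "z \<in> fixed_points C S \<inter> fixed_points D T"
      using z Tz by (simp add: fixed_points_def)
  qed
qed

text \<open>Chaining the two inequalities works at common fixed points; strictness ensures that the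
  composition has no others.\<close>

lemma quasinonexpansive_comp:
  assumes S: "quasinonexpansive C S" and T: "quasinonexpansive D T" and TD: "T ` D \<subseteq> C"
    and ne: "fixed_points C S \<inter> fixed_points D T \<noteq> {}"
    and strict: "strictly_quasinonexpansive C S \<or> strictly_quasinonexpansive D T"
  shows "quasinonexpansive D (S \<circ> T)"
  unfolding quasinonexpansive_def fixed_points_comp[OF assms]
proof (intro conjI ne ballI)
  fix z x assume z: "z \<in> fixed_points C S \<inter> fixed_points D T" and x: "x \<in> D"
  then have "phi z (S (T x)) \<le> phi z (T x)" "phi z (T x) \<le> phi z x"
    using S T TD unfolding quasinonexpansive_def by blast+
  then show "phi z ((S \<circ> T) x) \<le> phi z x" by simp
qed

lemma strongly_quasinonexpansive_comp:
  fixes C D :: "'a::real_normed_vector set"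
  assumes sm: "smooth_space TYPE('a)" and uc: "uniformly_convex_space TYPE('a)"
    and S: "quasinonexpansive C S" and T: "quasinonexpansive D T" and TD: "T ` D \<subseteq> C"
    and ne: "fixed_points C S \<inter> fixed_points D T \<noteq> {}"
    and sS: "strongly_quasinonexpansive C S" and sT: "strongly_quasinonexpansive D T"
  shows "strongly_quasinonexpansive D (S \<circ> T)"
proof -
  have fp: "fixed_points D (S \<circ> T) = fixed_points C S \<inter> fixed_points D T"
    using fixed_points_comp[OF S T TD ne]
      strongly_imp_strictly_quasinonexpansive[OF sm uc sS] by blast
  show ?thesis unfolding strongly_quasinonexpansive_def fp
  proof (intro conjI ne ballI allI impI)
    fix z and M \<epsilon> :: real
    assume "z \<in> fixed_points C S \<inter> fixed_points D T" and M: "0 < M" and \<epsilon>: "0 < \<epsilon>"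
    then have z: "z \<in> fixed_points C S" "z \<in> fixed_points D T" by blast+
    define R where "R = norm z + sqrt M"
    have R: "0 < R" using M by (simp add: R_def add_nonneg_pos)
    \<comment> \<open>Chosen so that the cross term is at most
      \<open>2 * (R + R) * \<eta> = \<epsilon> / 2\<close>, leaving \<open>\<epsilon> / 4\<close>
      for each of the two \<open>phi\<close> terms.\<close>
    define \<eta> where "\<eta> = \<epsilon> / (8 * R)"
    have "0 < \<eta>" using \<epsilon> R by (simp add: \<eta>_def)
    then obtain \<gamma> where \<gamma>: "0 < \<gamma>"
      and close: "\<And>w y :: 'a. norm y \<le> R \<Longrightarrow> phi w y < \<gamma> \<Longrightarrow> norm (w - y) < \<eta>"
      using phi_small_imp_close[OF sm uc R] by blast
    \<comment> \<open>The step made by \<open>S\<close> has two duties: \<gamma> makes it small in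
      norm, \<open>\<epsilon> / 4\<close> bounds its own \<open>phi\<close> term.\<close>
    have "0 < min \<gamma> (\<epsilon> / 4)" using \<gamma> \<epsilon> by simp
    then obtain \<delta>S where \<delta>S: "0 < \<delta>S" "\<forall>x \<in> C \<inter> phi_ball z M.
        phi z x - phi z (S x) < \<delta>S \<longrightarrow> phi (S x) x < min \<gamma> (\<epsilon> / 4)"
      using sS z(1) M unfolding strongly_quasinonexpansive_def by blast
    have "0 < \<epsilon> / 4" using \<epsilon> by simp
    then obtain \<delta>T where \<delta>T: "0 < \<delta>T" "\<forall>x \<in> D \<inter> phi_ball z M.
        phi z x - phi z (T x) < \<delta>T \<longrightarrow> phi (T x) x < \<epsilon> / 4"
      using sT z(2) M unfolding strongly_quasinonexpansive_def by blast
    show "\<exists>\<delta>>0. \<forall>x \<in> D \<inter> phi_ball z M.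
        phi z x - phi z ((S \<circ> T) x) < \<delta> \<longrightarrow> phi ((S \<circ> T) x) x < \<epsilon>"
    \<comment> \<open>The total decrease is the sum of the nonnegative decreases under
      \<open>T\<close> and under \<open>S\<close>, so each is below its own threshold.\<close>
    proof (intro exI[of _ "min \<delta>S \<delta>T"] conjI ballI impI)
      show "0 < min \<delta>S \<delta>T" using \<delta>S(1) \<delta>T(1) by simp
      fix x assume "x \<in> D \<inter> phi_ball z M"
        and dec: "phi z x - phi z ((S \<circ> T) x) < min \<delta>S \<delta>T"
      then have x: "x \<in> D" "phi z x \<le> M" by (auto simp: phi_ball_def)
      then have Tx: "T x \<in> C" using TD by blast
      have mono: "phi z (S (T x)) \<le> phi z (T x)" "phi z (T x) \<le> phi z x"
        using S T z x Tx unfolding quasinonexpansive_def by blast+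
      have "phi (T x) x < \<epsilon> / 4"
        using \<delta>T(2) x dec mono by (simp add: phi_ball_def)
      moreover have STx: "phi (S (T x)) (T x) < \<gamma>" "phi (S (T x)) (T x) < \<epsilon> / 4"
        using \<delta>S(2) x Tx dec mono by (simp_all add: phi_ball_def)
      moreover have n: "norm x \<le> R" "norm (T x) \<le> R"
        using norm_le_of_phi_le[OF sm] x mono unfolding R_def by (meson order_trans)+
      moreover have "2 * (norm (T x) + norm x) * norm (S (T x) - T x) \<le> 2 * (R + R) * \<eta>"
        using n R close[OF n(2) STx(1)] by (intro mult_mono) auto
      moreover have "2 * (R + R) * \<eta> = \<epsilon> / 2" using R by (simp add: \<eta>_def)
      ultimately show "phi ((S \<circ> T) x) x < \<epsilon>"
        using phi_le_three_point[OF sm, of "S (T x)" x "T x"] by simp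
    qed
  qed
qed

theorem theorem5p5:
  fixes C D :: "'a::banach set" and S T :: "'a \<Rightarrow> 'a"
  assumes "smooth_space TYPE('a)"
    and "C \<noteq> {}" and "D \<noteq> {}"
    and "quasinonexpansive C S" and "quasinonexpansive D T"
    and "T ` D \<subseteq> C"
    and "fixed_points C S \<inter> fixed_points D T \<noteq> {}"
  shows "(strictly_quasinonexpansive C S \<or> strictly_quasinonexpansive D T \<longrightarrow>
            fixed_points C S \<inter> fixed_points D T = fixed_points D (S \<circ> T) \<and>
            quasinonexpansive D (S \<circ> T)) \<and>
         (uniformly_convex_space TYPE('a) \<and>
          strongly_quasinonexpansive C S \<and> strongly_quasinonexpansive D T \<longrightarrow>
            strongly_quasinonexpansive D (S \<circ> T))"
proof (intro conjI impI; (elim conjE)?)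
  assume strict: "strictly_quasinonexpansive C S \<or> strictly_quasinonexpansive D T"
  show "fixed_points C S \<inter> fixed_points D T = fixed_points D (S \<circ> T)"
    using fixed_points_comp[OF assms(4-7) strict] by simp
  show "quasinonexpansive D (S \<circ> T)"
    by (rule quasinonexpansive_comp[OF assms(4-7) strict])
next
  assume "uniformly_convex_space TYPE('a)" "strongly_quasinonexpansive C S"
    "strongly_quasinonexpansive D T"
  then show "strongly_quasinonexpansive D (S \<circ> T)"
    by (rule strongly_quasinonexpansive_comp[OF assms(1) _ assms(4-7)])
qed

end
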